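(* For $n\ge1$, the map $f$ is a bijection between $\mathrm{NC}^{\mathrm{NN}}(n)$ and $\mathrm{CT}_B(n)$.
   Context: $[n]=\{1,\dots,n\}$. An edge of a partition of $[n]$ is a pair $(i,j)$, $i<j$, in the same block with no element of that block strictly between. $\mathrm{NC}(n)$: partitions of $[n]$ with no two edges $(a,b),(c,d)$, $a<c<b<d$. A block $B$ is nonnested if no edge $(i,j)$ has $i<\min B\le\max B<j$. $\mathrm{NC}^{\mathrm{NN}}(n)$ is the set of pairs $(\sigma,X)$ with $\sigma\in\mathrm{NC}(n)$ and $X$ a set of nonnested blocks of $\sigma$. Tableaux. A Ferrers diagram is a left-justified arrangement of cells with weakly decreasing row lengths from top to bottom, where rows and columns may be empty; its length is the number of rows plus the number of columns. Traverse its southeast boundary from the northeast corner to the southwest corner and label the steps $1,\dots,n$; each step is either a south step (the right end of a row; the row gets that label) or a west step (the bottom of a column; the column gets that label). If $F$ has $k$ columns, the shifted diagram $\overline F$ is obtained by placing above $F$ new rows of lengths $1,2,\dots,k$ (from top to bottom), left-justified; the rightmost cell of a new row is its diagonal cell, and a new row whose diagonal cell lies in the column labelled $i$ is labelled $-i$. The $(i,j)$-entry is the cell in the row labelled $i$ and column labelled $j$. A permutation tableau of type $B_n$ is a $0,1$-filling of $\overline F$ for some Ferrers diagram $F$ of length $n$ such that (1) each column has at least one $1$; (2) no $0$ has both a $1$ above it in its column and a $1$ to its left in its row; (3) no $0$ in a diagonal cell has a $1$ to its left in its row. $\mathrm{CT}_B(n)$ is the set of permutation tableaux of type $B_n$ with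 exactly one $1$ in each column. The map $f$. For $(\sigma,X)\in\mathrm{NC}^{\mathrm{NN}}(n)$, let $F$ be the Ferrers diagram of length $n$ whose $i$-th boundary step is south iff $i$ is the minimum of a block of $\sigma$ not in $X$. Fill $\overline F$: for each $i$ that is the minimum of a block in $X$, put $1$ in the $(-i,i)$-entry; for each pair of distinct $i,j$ in a common block $B$ with $i=\min B$, put $1$ in the $(-i,j)$-entry if $B\in X$ and in the $(i,j)$-entry otherwise; all other cells get $0$. This filling is $f(\sigma,X)$. *)

theory Defs
  imports "HOL-Library.Disjoint_Sets" "HOL-Library.FuncSet"
begin

section \<open>Noncrossing partitions\<close>

definition edges :: "nat set set \<Rightarrow> (nat \<times> nat) set" where
  "edges \<sigma> = {(i, j). i < j \<and> (\<exists>B\<in>\<sigma>. i \<in> B \<and> j \<in> B \<and> \<not> (\<exists>m\<in>B. i < m \<and> m < j))}"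

definition NC :: "nat \<Rightarrow> nat set set set" where
  "NC n = {\<sigma>. partition_on {1..n} \<sigma> \<and>
     \<not> (\<exists>a b c d. (a, b) \<in> edges \<sigma> \<and> (c, d) \<in> edges \<sigma> \<and> a < c \<and> c < b \<and> b < d)}"

definition nonnested :: "nat set set \<Rightarrow> nat set \<Rightarrow> bool" where
  "nonnested \<sigma> B \<longleftrightarrow> \<not> (\<exists>(i, j)\<in>edges \<sigma>. i < Min B \<and> Max B < j)"

definition NC_NN :: "nat \<Rightarrow> (nat set set \<times> nat set set) set" where
  "NC_NN n = {(\<sigma>, X). \<sigma> \<in> NC n \<and> X \<subseteq> {B \<in> \<sigma>. nonnested \<sigma> B}}"


section \<open>Ferrers diagrams and their boundary labels\<close>

text \<open>
  A diagram is given by its number of columns and the lengths of its rows from top to bottom.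
  The number of columns is part of the data because columns may be empty.
\<close>

datatype ferrers = Ferrers (num_cols: nat) (row_lens: "nat list")

definition ferrers_diagram :: "ferrers \<Rightarrow> bool" where
  "ferrers_diagram F \<longleftrightarrow>
     sorted_wrt (\<ge>) (row_lens F) \<and> (\<forall>l\<in>set (row_lens F). l \<le> num_cols F)"

definition ferrers_length :: "ferrers \<Rightarrow> nat" where
  "ferrers_length F = length (row_lens F) + num_cols F"

datatype step = South | West

text \<open>
  The southeast boundary from the northeast to the southwest corner. The first argument of
  \<open>boundary_from\<close> is the current horizontal distance from the left side, the second one lists
  the lengths of the rows that are still below: walk west to the right end of the next row,
  then south along it.
\<close>

fun boundary_from :: "nat \<Rightarrow> nat list \<Rightarrow> step list" where
  "boundary_from x [] = replicate x West"
| "boundary_from x (l # ls) = replicate (x - l) West @ South # boundary_from l ls"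

definition boundary :: "ferrers \<Rightarrow> step list" where
  "boundary F = boundary_from (num_cols F) (row_lens F)"

text \<open>Boundary steps are numbered from 1, whereas list positions start at 0.\<close>

definition boundary_step :: "ferrers \<Rightarrow> nat \<Rightarrow> step" where
  "boundary_step F i = boundary F ! (i - 1)"

definition labels :: "step \<Rightarrow> ferrers \<Rightarrow> nat list" where
  "labels s F = filter (\<lambda>i. boundary_step F i = s) [1..<Suc (ferrers_length F)]"

text \<open>
  Rows are indexed from the top and columns from the left, starting at 0. The boundary meets
  the rows from top to bottom but the columns from right to left, whence the reversal.
\<close>

definition row_label :: "ferrers \<Rightarrow> nat \<Rightarrow> nat" where
  "row_label F r = labels South F ! r"

definition col_label :: "ferrers \<Rightarrow> nat \<Rightarrow> nat" where
  "col_label F c = rev (labels West F) ! c"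


section \<open>Shifted diagrams and permutation tableaux of type B\<close>

definition shifted_row_lens :: "ferrers \<Rightarrow> nat list" where
  "shifted_row_lens F = [1..<Suc (num_cols F)] @ row_lens F"

definition shifted_cells :: "ferrers \<Rightarrow> (nat \<times> nat) set" where
  "shifted_cells F =
     {(r, c). r < length (shifted_row_lens F) \<and> c < shifted_row_lens F ! r}"

text \<open>
  With \<open>k\<close> columns, the new rows of the shifted diagram are the rows \<open>r < k\<close>; the new row \<open>r\<close>
  has length \<open>r + 1\<close>, so its diagonal cell is \<open>(r, r)\<close>.
\<close>

definition shifted_row_label :: "ferrers \<Rightarrow> nat \<Rightarrow> int" where
  "shifted_row_label F r =
     (if r < num_cols F then - int (col_label F r) else int (row_label F (r - num_cols F)))"

text \<open>Fillings are functions on the cells, made extensional outside the diagram.\<close>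

definition PT_B :: "nat \<Rightarrow> (ferrers \<times> (nat \<times> nat \<Rightarrow> nat)) set" where
  "PT_B n = {(F, T). ferrers_diagram F \<and> ferrers_length F = n \<and>
     T \<in> shifted_cells F \<rightarrow>\<^sub>E {0, 1} \<and>
     (\<forall>c<num_cols F. \<exists>r. (r, c) \<in> shifted_cells F \<and> T (r, c) = 1) \<and>
     (\<forall>(r, c)\<in>shifted_cells F. T (r, c) = 0 \<longrightarrow>
        \<not> ((\<exists>r'<r. (r', c) \<in> shifted_cells F \<and> T (r', c) = 1) \<and>
           (\<exists>c'<c. (r, c') \<in> shifted_cells F \<and> T (r, c') = 1))) \<and>
     (\<forall>r<num_cols F. T (r, r) = 0 \<longrightarrow>
        \<not> (\<exists>c'<r. (r, c') \<in> shifted_cells F \<and> T (r, c') = 1))}"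

definition CT_B :: "nat \<Rightarrow> (ferrers \<times> (nat \<times> nat \<Rightarrow> nat)) set" where
  "CT_B n = {(F, T) \<in> PT_B n.
     \<forall>c<num_cols F. \<exists>!r. (r, c) \<in> shifted_cells F \<and> T (r, c) = 1}"


section \<open>The map\<close>

definition shape_of :: "nat \<Rightarrow> nat set set \<Rightarrow> nat set set \<Rightarrow> ferrers" where
  "shape_of n \<sigma> X = (THE F. ferrers_diagram F \<and> ferrers_length F = n \<and>
     (\<forall>i\<in>{1..n}. boundary_step F i = South \<longleftrightarrow> (\<exists>B\<in>\<sigma> - X. i = Min B)))"

text \<open>The labels \<open>(row, column)\<close> of the entries that receive a 1.\<close>

definition one_entries :: "nat set set \<Rightarrow> nat set set \<Rightarrow> (int \<times> nat) set" where
  "one_entries \<sigma> X =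
     {(- int (Min B), Min B) |B. B \<in> X} \<union>
     {(- int (Min B), j) |B j. B \<in> X \<and> j \<in> B \<and> j \<noteq> Min B} \<union>
     {(int (Min B), j) |B j. B \<in> \<sigma> - X \<and> j \<in> B \<and> j \<noteq> Min B}"

definition f_map ::
    "nat \<Rightarrow> nat set set \<times> nat set set \<Rightarrow> ferrers \<times> (nat \<times> nat \<Rightarrow> nat)" where
  "f_map n = (\<lambda>(\<sigma>, X).
     let F = shape_of n \<sigma> X
     in (F, \<lambda>(r, c)\<in>shifted_cells F.
              if (shifted_row_label F r, col_label F c) \<in> one_entries \<sigma> X then 1 else 0))"


text \<open>The description of the shape by its boundary is a proper definite description.\<close>

lemma boundary_from_unique:
  "\<exists>!F. ferrers_diagram F \<and> boundary F = p"
proof (induction p)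
  case Nil
  show ?case
  proof (rule ex1I[of _ "Ferrers 0 []"])
    show "ferrers_diagram (Ferrers 0 []) \<and> boundary (Ferrers 0 []) = []"
      by (simp add: ferrers_diagram_def boundary_def)
    fix F assume "ferrers_diagram F \<and> boundary F = []"
    then show "F = Ferrers 0 []"
      by (cases F; cases "row_lens F") (auto simp: boundary_def)
  qed
next
  case (Cons s p)
  then obtain k ls where ex: "ferrers_diagram (Ferrers k ls)" "boundary (Ferrers k ls) = p"
    and un: "\<And>F. ferrers_diagram F \<Longrightarrow> boundary F = p \<Longrightarrow> F = Ferrers k ls"
    by (metis ferrers.exhaust)
  show ?case
  proof (cases s)
    case South
    show ?thesis
    proof (rule ex1I[of _ "Ferrers k (k # ls)"])
      show "ferrers_diagram (Ferrers k (k # ls)) \<and> boundary (Ferrers k (k # ls)) = s # p"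
        using ex South by (auto simp: ferrers_diagram_def boundary_def)
      fix F assume F: "ferrers_diagram F \<and> boundary F = s # p"
      obtain x ms where Fx: "F = Ferrers x ms" by (cases F)
      obtain m ms' where ms: "ms = m # ms'"
        using F Fx South by (cases ms; cases x) (auto simp: boundary_def)
      have "x - m = 0" using F Fx ms South by (cases "x - m") (auto simp: boundary_def)
      then have xm: "x = m" using F Fx ms by (auto simp: ferrers_diagram_def)
      have "Ferrers m ms' = Ferrers k ls"
        using F Fx ms xm South by (intro un) (auto simp: ferrers_diagram_def boundary_def)
      then show "F = Ferrers k (k # ls)" using Fx ms xm by simp
    qed
  next
    case West
    have shift: "boundary (Ferrers (Suc y) ms) = West # boundary (Ferrers y ms)"
      if "\<forall>l\<in>set ms. l \<le> y" for y ms
      using that by (cases ms) (auto simp: boundary_def Suc_diff_le)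
    show ?thesis
    proof (rule ex1I[of _ "Ferrers (Suc k) ls"])
      show "ferrers_diagram (Ferrers (Suc k) ls) \<and> boundary (Ferrers (Suc k) ls) = s # p"
        using ex West by (auto simp: ferrers_diagram_def shift)
      fix F assume F: "ferrers_diagram F \<and> boundary F = s # p"
      obtain x ms where Fx: "F = Ferrers x ms" by (cases F)
      have lt: "x \<noteq> 0 \<and> (\<forall>l\<in>set ms. l < x)"
      proof (cases ms)
        case Nil
        then show ?thesis using F Fx West by (cases x) (auto simp: boundary_def)
      next
        case (Cons m ms')
        have "x - m \<noteq> 0" using F Fx Cons West by (auto simp: boundary_def)
        then show ?thesis using F Fx Cons by (auto simp: ferrers_diagram_def)
      qed
      then obtain y where y: "x = Suc y" by (cases x) auto
      have le: "\<forall>l\<in>set ms. l \<le> y" using lt y by auto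
      have "Ferrers y ms = Ferrers k ls"
        using F Fx y le West by (intro un) (auto simp: ferrers_diagram_def shift)
      then show "F = Ferrers (Suc k) ls" using Fx y by simp
    qed
  qed
qed

lemma length_boundary:
  assumes "ferrers_diagram F"
  shows "length (boundary F) = ferrers_length F"
proof -
  have "length (boundary_from x ls) = length ls + x"
    if "sorted_wrt (\<ge>) ls" "\<forall>l\<in>set ls. l \<le> x" for x ls
    using that by (induction x ls rule: boundary_from.induct) auto
  then show ?thesis
    using assms by (simp add: ferrers_diagram_def boundary_def ferrers_length_def)
qed

lemma shape_unique:
  "\<exists>!F. ferrers_diagram F \<and> ferrers_length F = n \<and>
     (\<forall>i\<in>{1..n}. boundary_step F i = South \<longleftrightarrow> P i)"
proof -
  let ?p = "map (\<lambda>i. if P i then South else West) [1..<Suc n]"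
  have "ferrers_length F = n \<and> (\<forall>i\<in>{1..n}. boundary_step F i = South \<longleftrightarrow> P i)
      \<longleftrightarrow> boundary F = ?p" if "ferrers_diagram F" for F
  proof
    assume A: "ferrers_length F = n \<and> (\<forall>i\<in>{1..n}. boundary_step F i = South \<longleftrightarrow> P i)"
    show "boundary F = ?p"
    proof (rule nth_equalityI)
      show "length (boundary F) = length ?p" using A length_boundary[OF that] by simp
      fix i assume "i < length (boundary F)"
      then have i: "i < n" using A length_boundary[OF that] by simp
      then have "boundary F ! i = South \<longleftrightarrow> P (Suc i)"
        using A by (auto simp: boundary_step_def dest: bspec[of _ _ "Suc i"])
      then show "boundary F ! i = ?p ! i"
        using i by (cases "boundary F ! i") (auto simp del: upt_Suc)
    qed
  next
    assume B: "boundary F = ?p"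
    then have "ferrers_length F = n" using length_boundary[OF that] by (simp del: upt_Suc)
    then show "ferrers_length F = n \<and> (\<forall>i\<in>{1..n}. boundary_step F i = South \<longleftrightarrow> P i)"
      using B by (auto simp: boundary_step_def simp del: upt_Suc split: if_splits)
  qed
  then show ?thesis using boundary_from_unique[of ?p] by metis
qed

end

theory Submission imports Defs begin

text \<open>
  Encode \<open>(\<sigma>, X)\<close> by the function \<open>G\<close> sending \<open>j\<close> to the minimum of its block, with a minus sign if
  the block is in \<open>X\<close>. Rows of the shifted diagram have increasing labels from top to bottom,
  columns have decreasing labels from left to right, and the cell \<open>(i, j)\<close> exists iff
  \<open>\<bar>i\<bar> \<le> j\<close>. A filling with a single one in each column is therefore a function from column labels
  to row labels with \<open>\<bar>G j\<bar> \<le> j\<close>; extend it by \<open>G i = i\<close> on the labels of south steps. The diagonal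
  condition then says that \<open>G \<bar>G j\<bar> = G j\<close>, and the remaining condition that there are no
  \<open>i < j\<close> with \<open>G i < G j\<close> and \<open>\<bar>G j\<bar> \<le> i\<close>. Such a pair is exactly what a crossing of
  \<open>\<sigma>\<close>, or an edge of \<open>\<sigma>\<close> above a block of \<open>X\<close>, gives rise to.
\<close>

section \<open>Signed codes\<close>

text \<open>The first condition makes \<open>nat \<bar>G j\<bar>\<close> the least element of the
  level set of \<open>j\<close> and prevents a number and its negative from both being values. So
  the values are signed minima of the level sets. \<open>extensional\<close> lets a code be
  determined by its values on \<open>{1..n}\<close>.\<close>

definition signed_codes :: "nat \<Rightarrow> (nat \<Rightarrow> int) set" where
  "signed_codes n = {G \<in> extensional {1..n}.
     (\<forall>j\<in>{1..n}. G j \<noteq> 0 \<and> nat \<bar>G j\<bar> \<le> j \<and> G (nat \<bar>G j\<bar>) = G j) \<and>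
     (\<forall>i\<in>{1..n}. \<forall>j\<in>{1..n}. i < j \<longrightarrow> G i < G j \<longrightarrow> i < nat \<bar>G j\<bar>)}"

definition partition_code :: "nat \<Rightarrow> nat set set \<times> nat set set \<Rightarrow> nat \<Rightarrow> int" where
  "partition_code n = (\<lambda>(\<sigma>, X). \<lambda>j\<in>{1..n}.
     let B = (THE B. B \<in> \<sigma> \<and> j \<in> B) in if B \<in> X then - int (Min B) else int (Min B))"

definition fibre :: "nat \<Rightarrow> (nat \<Rightarrow> int) \<Rightarrow> nat \<Rightarrow> nat set" where
  "fibre n G i = {j \<in> {1..n}. G j = G i}"

definition code_partition :: "nat \<Rightarrow> (nat \<Rightarrow> int) \<Rightarrow> nat set set \<times> nat set set" where
  "code_partition n G = (fibre n G ` {1..n}, fibre n G ` {i \<in> {1..n}. G i < 0})"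

section \<open>Partitions obtained from signed codes\<close>

lemma signed_codesD:
  assumes "G \<in> signed_codes n" "j \<in> {1..n}"
  shows "G j \<noteq> 0" "nat \<bar>G j\<bar> \<le> j" "nat \<bar>G j\<bar> \<in> {1..n}" "G (nat \<bar>G j\<bar>) = G j"
proof -
  show 1: "G j \<noteq> 0" "nat \<bar>G j\<bar> \<le> j" "G (nat \<bar>G j\<bar>) = G j"
    using assms by (auto simp: signed_codes_def)
  then show "nat \<bar>G j\<bar> \<in> {1..n}" using assms(2) by auto
qed

lemma signed_codes_less:
  assumes "G \<in> signed_codes n" "i \<in> {1..n}" "j \<in> {1..n}" "i < j" "G i < G j"
  shows "i < nat \<bar>G j\<bar>"
  using assms by (auto simp: signed_codes_def)

text \<open>Passes from signed values to block minima, the form needed against crossings. If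
  \<open>G j\<close> is positive, the order condition is applied to \<open>i\<close> and
  \<open>j\<close> themselves. Otherwise it is applied to \<open>nat \<bar>G j\<bar>\<close> and
  \<open>i\<close>: the value at the former is \<open>G j\<close>, which is negative and of larger
  absolute value than \<open>G i\<close>, hence below it.\<close>

lemma signed_codes_no_crossing:
  assumes G: "G \<in> signed_codes n" and i: "i \<in> {1..n}" and j: "j \<in> {1..n}" and ij: "i < j"
    and less: "\<bar>G i\<bar> < \<bar>G j\<bar>" and le: "nat \<bar>G j\<bar> \<le> i"
  shows False
proof (cases "G j > 0")
  case True
  then have "G i < G j" using less by linarith
  then show False using signed_codes_less[OF G i j ij] le by simp
next
  case False
  let ?m = "nat \<bar>G j\<bar>"
  have m: "?m \<in> {1..n}" "G ?m = G j" using signed_codesD[OF G j] by auto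
  have "?m \<noteq> i" using m less by auto
  moreover have "G ?m < G i" using m less False by linarith
  ultimately have "?m < nat \<bar>G i\<bar>" using signed_codes_less[OF G m(1) i] le by simp
  then show False using less by simp
qed

lemma fibre_self: "i \<in> {1..n} \<Longrightarrow> i \<in> fibre n G i"
  by (simp add: fibre_def)

lemma fibre_eq_iff:
  assumes "i \<in> {1..n}" "j \<in> {1..n}"
  shows "fibre n G i = fibre n G j \<longleftrightarrow> G i = G j"
  using assms by (auto simp: fibre_def)

text \<open>\<open>G\<close> takes the value \<open>G i\<close> at
  \<open>nat \<bar>G i\<bar>\<close>, so this number is in the fibre; it is a lower bound because
  \<open>nat \<bar>G j\<bar> \<le> j\<close> for every member \<open>j\<close>.\<close>

lemma Min_fibre:
  assumes "G \<in> signed_codes n" "i \<in> {1..n}"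
  shows "Min (fibre n G i) = nat \<bar>G i\<bar>"
proof (rule Min_eqI)
  show "finite (fibre n G i)" by (simp add: fibre_def)
  show "nat \<bar>G i\<bar> \<in> fibre n G i" using signed_codesD[OF assms] by (simp add: fibre_def)
  fix j assume "j \<in> fibre n G i"
  then show "nat \<bar>G i\<bar> \<le> j" using signed_codesD(2)[OF assms(1), of j] by (auto simp: fibre_def)
qed

lemma partition_on_fibres: "partition_on {1..n} (fibre n G ` {1..n})"
  by (rule partition_onI) (auto simp: fibre_def disjnt_def)

text \<open>In a crossing \<open>a < c < b < d\<close>, the pair \<open>b < d\<close> contradicts
  \<open>signed_codes_no_crossing\<close> if the block of \<open>d\<close> has the larger minimum,
  and the pair \<open>c < b\<close> does if the block of \<open>b\<close> has. An edge above a block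
  with negative value contradicts the order condition at the minimum of that block and the right end
  of the edge.\<close>

lemma code_partition_NC_NN:
  assumes G: "G \<in> signed_codes n"
  shows "code_partition n G \<in> NC_NN n"
proof -
  let ?\<sigma> = "fibre n G ` {1..n}"
  have edgeD: "i \<in> {1..n}" "j \<in> {1..n}" "i < j" "G i = G j" "\<And>m. i < m \<Longrightarrow> m < j \<Longrightarrow> G m \<noteq> G i"
    if e: "(i, j) \<in> edges ?\<sigma>" for i j
  proof -
    obtain k where k: "i \<in> fibre n G k" "j \<in> fibre n G k" "i < j"
      and between: "\<not> (\<exists>m\<in>fibre n G k. i < m \<and> m < j)"
      using e unfolding edges_def by blast
    show "i \<in> {1..n}" "j \<in> {1..n}" "i < j" "G i = G j" using k by (auto simp: fibre_def)
    fix m assume "i < m" "m < j"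
    then show "G m \<noteq> G i" using k between by (auto simp: fibre_def)
  qed
  have "False" if ab: "(a, b) \<in> edges ?\<sigma>" and cd: "(c, d) \<in> edges ?\<sigma>"
    and *: "a < c" "c < b" "b < d"
    for a b c d
  proof -
    note ab = edgeD[OF ab] and cd = edgeD[OF cd]
    \<comment> \<open>Values with the same absolute value agree, both being the value of
      \<open>G\<close> at that absolute value. But \<open>c\<close> lies strictly inside the edge
      \<open>(a, b)\<close>, hence in another block.\<close>
    have "\<bar>G a\<bar> \<noteq> \<bar>G c\<bar>"
      using ab(5)[OF *(1,2)] signed_codesD(4)[OF G ab(1)] signed_codesD(4)[OF G cd(1)] by auto
    then consider "\<bar>G b\<bar> < \<bar>G d\<bar>" | "\<bar>G c\<bar> < \<bar>G b\<bar>" using ab(4) cd(4) by linarith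
    then show False
    proof cases
      case 1
      have "nat \<bar>G d\<bar> \<le> b" using signed_codesD(2)[OF G cd(1)] cd(4) * by simp
      then show False using signed_codes_no_crossing[OF G ab(2) cd(2) *(3) 1] by simp
    next
      case 2
      have "nat \<bar>G b\<bar> \<le> c" using signed_codesD(2)[OF G ab(1)] ab(4) * by simp
      then show False using signed_codes_no_crossing[OF G cd(1) ab(2) *(2) 2] by simp
    qed
  qed
  then have "?\<sigma> \<in> NC n" using partition_on_fibres by (auto simp: NC_def)
  moreover have "nonnested ?\<sigma> (fibre n G k)" if k: "k \<in> {1..n}" "G k < 0" for k
  proof -
    have False if e: "(i, j) \<in> edges ?\<sigma>" and i: "i < Min (fibre n G k)"
      and j: "Max (fibre n G k) < j" for i j
    proof -
      note e = edgeD[OF e]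
      let ?m = "nat \<bar>G k\<bar>"
      have m: "?m \<in> {1..n}" "G ?m = G k" using signed_codesD[OF G k(1)] by auto
      have im: "i < ?m" using i Min_fibre[OF G k(1)] by simp
      have "?m \<le> Max (fibre n G k)" using m by (intro Max_ge) (auto simp: fibre_def)
      then have mj: "?m < j" using j by simp
      have le: "nat \<bar>G j\<bar> \<le> i" using signed_codesD(2)[OF G e(1)] e(4) by simp
      \<comment> \<open>\<open>G ?m\<close> is the negative of \<open>?m\<close>, and
        \<open>\<bar>G j\<bar>\<close> is less than \<open>?m\<close>, so the inequality holds for
        either sign of \<open>G j\<close>.\<close>
      then have "G ?m < G j" using im m k by linarith
      then show False using signed_codes_less[OF G m(1) e(2) mj] le im by linarith
    qed
    then show ?thesis by (auto simp: nonnested_def)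
  qed
  ultimately show ?thesis by (auto simp: NC_NN_def code_partition_def)
qed

section \<open>Signed codes obtained from partitions\<close>

lemma partition_on_block_unique:
  assumes "partition_on A \<sigma>" "B \<in> \<sigma>" "C \<in> \<sigma>" "x \<in> B" "x \<in> C"
  shows "B = C"
  using assms by (auto simp: partition_on_def dest: disjointD)

lemma partition_code_apply:
  assumes "partition_on {1..n} \<sigma>" "B \<in> \<sigma>" "j \<in> B"
  shows "partition_code n (\<sigma>, X) j = (if B \<in> X then - int (Min B) else int (Min B))"
proof -
  have "(THE B. B \<in> \<sigma> \<and> j \<in> B) = B"
    using assms partition_on_block_unique[OF assms(1)] by (intro the_equality) auto
  moreover have "j \<in> {1..n}" using assms by (auto simp: partition_on_def)
  ultimately show ?thesis by (simp add: partition_code_def)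
qed

lemma partition_on_block:
  assumes "partition_on {1..n::nat} \<sigma>" "B \<in> \<sigma>"
  shows "finite B" "B \<subseteq> {1..n}" "Min B \<in> B" "Min B \<in> {1..n}"
proof -
  show 1: "B \<subseteq> {1..n}" using assms by (auto simp: partition_on_def)
  then show 2: "finite B" by (rule finite_subset) simp
  moreover have "B \<noteq> {}" using assms by (auto simp: partition_on_def)
  ultimately show "Min B \<in> B" by simp
  then show "Min B \<in> {1..n}" using 1 by blast
qed

lemma partition_on_Min_eq:
  assumes "partition_on {1..n::nat} \<sigma>" "B \<in> \<sigma>" "C \<in> \<sigma>" "Min B = Min C"
  shows "B = C"
  using assms partition_on_block(3) partition_on_block_unique by metis

lemma partition_on_obtain:
  assumes "partition_on {1..n::nat} \<sigma>" "j \<in> {1..n}"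
  obtains B where "B \<in> \<sigma>" "j \<in> B"
  using assms unfolding partition_on_def by blast

text \<open>The edge joins the last element of \<open>B\<close> before \<open>y\<close> to the first
  one after \<open>y\<close>.\<close>

lemma edge_around:
  fixes B :: "nat set"
  assumes "B \<in> \<sigma>" "finite B" "x \<in> B" "z \<in> B" "x < y" "y < z" "y \<notin> B"
  obtains p q where "(p, q) \<in> edges \<sigma>" "p \<in> B" "q \<in> B" "p < y" "y < q"
proof -
  let ?L = "{b \<in> B. b < y}" and ?U = "{b \<in> B. y < b}"
  have L: "finite ?L" "?L \<noteq> {}" and U: "finite ?U" "?U \<noteq> {}" using assms by auto
  have p: "Max ?L \<in> ?L" and q: "Min ?U \<in> ?U" using Max_in[OF L] Min_in[OF U] by auto
  have "\<not> (Max ?L < m \<and> m < Min ?U)" if m: "m \<in> B" for m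
  proof (cases m y rule: linorder_cases)
    case less
    then have "m \<le> Max ?L" using m L(1) by (intro Max_ge) auto
    then show ?thesis by simp
  next
    case greater
    then have "Min ?U \<le> m" using m U(1) by (intro Min_le) auto
    then show ?thesis by simp
  qed (use m assms in auto)
  then have "(Max ?L, Min ?U) \<in> edges \<sigma>" using p q assms(1) unfolding edges_def by auto
  then show thesis using that p q by auto
qed

text \<open>The edge \<open>(p, q)\<close> of \<open>C\<close> around \<open>y\<close> covers all of
  \<open>B\<close>: an element of \<open>B\<close> outside it would give \<open>B\<close> an edge
  around \<open>p\<close> or around \<open>q\<close>. Such an edge either crosses
  \<open>(p, q)\<close> or spans it, and in the latter case it jumps over \<open>y\<close>, an
  element of \<open>B\<close>.\<close>

lemma noncrossing_below_edge:
  assumes \<sigma>: "\<sigma> \<in> NC n" and B: "B \<in> \<sigma>" "y \<in> B" and C: "C \<in> \<sigma>" "x \<in> C" "z \<in> C"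
    and ne: "B \<noteq> C" and xyz: "x < y" "y < z"
  obtains p q where "(p, q) \<in> edges \<sigma>" "p \<in> C" "p < Min B" "Max B < q"
proof -
  have part: "partition_on {1..n} \<sigma>" using \<sigma> by (simp add: NC_def)
  have nc: False if "(a, b) \<in> edges \<sigma>" "(c, d) \<in> edges \<sigma>" "a < c" "c < b" "b < d" for a b c d
    using \<sigma> that unfolding NC_def by blast
  have dj: "u \<notin> C" if "u \<in> B" for u
    using that partition_on_block_unique[OF part B(1) C(1)] ne by blast
  note fB = partition_on_block[OF part B(1)] and fC = partition_on_block[OF part C(1)]
  obtain p q where e: "(p, q) \<in> edges \<sigma>" "p \<in> C" "q \<in> C" "p < y" "y < q"
    using edge_around[OF C(1) fC(1) C(2,3) xyz dj[OF B(2)]] by blast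
  have pB: "p \<notin> B" "q \<notin> B" using dj e by auto
  have "p < u \<and> u < q" if u: "u \<in> B" for u
  proof (rule ccontr)
    assume "\<not> (p < u \<and> u < q)"
    then consider "u < p" | "q < u" using u pB by (metis linorder_cases)
    then show False
    proof cases
      case 1
      have "p < y" by fact
      from edge_around[OF B(1) fB(1) u B(2) 1 this pB(1)]
      obtain a b where ab: "(a, b) \<in> edges \<sigma>" "a \<in> B" "b \<in> B" "a < p" "p < b" .
      show False
      proof (cases "b < q")
        case True then show False using nc[OF ab(1) e(1)] ab by simp
      next
        case False
        have "a < y" "y < b" using False ab e by linarith+
        \<comment> \<open>Unfolding \<open>edges\<close> only yields some block in which nothing
          lies between \<open>a\<close> and \<open>b\<close>; it is \<open>B\<close> because it
          contains \<open>a\<close>.\<close>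
        obtain D where "D \<in> \<sigma>" "a \<in> D" "\<not> (\<exists>m\<in>D. a < m \<and> m < b)"
          using ab(1) by (auto simp: edges_def)
        then show False
          using partition_on_block_unique[OF part B(1), of D a] ab B \<open>a < y\<close> \<open>y < b\<close> by blast
      qed
    next
      case 2
      have "y < q" by fact
      from edge_around[OF B(1) fB(1) B(2) u this 2 pB(2)]
      obtain a b where ab: "(a, b) \<in> edges \<sigma>" "a \<in> B" "b \<in> B" "a < q" "q < b" .
      show False
      proof (cases "p < a")
        case True then show False using nc[OF e(1) ab(1)] ab by simp
      next
        case False
        have "a < y" "y < b" using False ab e by linarith+
        obtain D where "D \<in> \<sigma>" "a \<in> D" "\<not> (\<exists>m\<in>D. a < m \<and> m < b)"
          using ab(1) by (auto simp: edges_def)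
        then show False
          using partition_on_block_unique[OF part B(1), of D a] ab B \<open>a < y\<close> \<open>y < b\<close> by blast
      qed
    qed
  qed
  moreover have "Max B \<in> B" using B fB by (auto intro: Max_in)
  ultimately show thesis using that[OF e(1,2)] fB by blast
qed

text \<open>A pair \<open>i < j\<close> violating the order condition puts \<open>i\<close> strictly
  between the minimum of the block \<open>C\<close> of \<open>j\<close> and \<open>j\<close> itself,
  so the block \<open>B\<close> of \<open>i\<close> lies below an edge of \<open>C\<close>. Being
  nested, \<open>B\<close> is outside \<open>X\<close>, and the value at \<open>i\<close> is
  \<open>Min B\<close>, which exceeds \<open>Min C\<close> and hence the value at
  \<open>j\<close>.\<close>

lemma partition_code_signed_codes:
  assumes "(\<sigma>, X) \<in> NC_NN n"
  shows "partition_code n (\<sigma>, X) \<in> signed_codes n"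
proof -
  let ?G = "partition_code n (\<sigma>, X)"
  have \<sigma>: "\<sigma> \<in> NC n" and X: "X \<subseteq> {B \<in> \<sigma>. nonnested \<sigma> B}" using assms by (auto simp: NC_NN_def)
  then have part: "partition_on {1..n} \<sigma>" by (simp add: NC_def)
  note G = partition_code_apply[OF part, of _ _ X]
  have "?G j \<noteq> 0 \<and> nat \<bar>?G j\<bar> \<le> j \<and> ?G (nat \<bar>?G j\<bar>) = ?G j" if j: "j \<in> {1..n}" for j
  proof -
    obtain B where B: "B \<in> \<sigma>" "j \<in> B" using partition_on_obtain[OF part j] .
    note b = partition_on_block[OF part B(1)]
    show ?thesis using G[OF B] G[OF B(1) b(3)] b B by auto
  qed
  moreover have "i < nat \<bar>?G j\<bar>" if i: "i \<in> {1..n}" and j: "j \<in> {1..n}" and ij: "i < j"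
    and less: "?G i < ?G j" for i j
  proof (rule ccontr)
    assume not: "\<not> i < nat \<bar>?G j\<bar>"
    obtain B where B: "B \<in> \<sigma>" "i \<in> B" using partition_on_obtain[OF part i] .
    obtain C where C: "C \<in> \<sigma>" "j \<in> C" using partition_on_obtain[OF part j] .
    note b = partition_on_block[OF part B(1)] and c = partition_on_block[OF part C(1)]
    have ne: "B \<noteq> C" using less G[OF B] G[OF C] by auto
    have "i \<notin> C" using ne B partition_on_block_unique[OF part B(1) C(1)] by blast
    moreover have "Min C \<le> i" using not G[OF C] by (auto split: if_splits)
    ultimately have "Min C < i" using c(3) by (metis le_neq_implies_less)
    from noncrossing_below_edge[OF \<sigma> B C(1) c(3) C(2) ne this ij]
    obtain p q where e: "(p, q) \<in> edges \<sigma>" "p \<in> C" "p < Min B" "Max B < q" .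
    then have "B \<notin> X" using X by (auto simp: nonnested_def)
    then have "?G i = int (Min B)" using G[OF B] by simp
    moreover have "Min C < Min B" using e Min_le[OF c(1) e(2)] by simp
    ultimately show False using less G[OF C] by (auto split: if_splits)
  qed
  moreover have "?G \<in> extensional {1..n}" by (simp add: partition_code_def)
  ultimately show ?thesis by (auto simp: signed_codes_def)
qed

text \<open>Distinct blocks have distinct minima, and since all minima are positive, attaching signs
  cannot make two of them coincide.\<close>

lemma fibre_partition_code:
  assumes part: "partition_on {1..n} \<sigma>" and B: "B \<in> \<sigma>" "i \<in> B"
  shows "fibre n (partition_code n (\<sigma>, X)) i = B"
proof -
  note G = partition_code_apply[OF part, of _ _ X]
  have "partition_code n (\<sigma>, X) j = partition_code n (\<sigma>, X) i \<longleftrightarrow> j \<in> B" if j: "j \<in> {1..n}" for j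
  proof -
    obtain C where C: "C \<in> \<sigma>" "j \<in> C" using partition_on_obtain[OF part j] .
    have pos: "Min B > 0" "Min C > 0"
      using partition_on_block(4)[OF part] B C by fastforce+
    have "j \<in> B \<longleftrightarrow> C = B" using C partition_on_block_unique[OF part B(1) C(1)] by blast
    also have "\<dots> \<longleftrightarrow> Min C = Min B" using partition_on_Min_eq[OF part C(1) B(1)] by auto
    also have "\<dots> \<longleftrightarrow> partition_code n (\<sigma>, X) j = partition_code n (\<sigma>, X) i"
      using G[OF B] G[OF C] pos partition_on_Min_eq[OF part C(1) B(1)] by auto
    finally show ?thesis by simp
  qed
  then show ?thesis using partition_on_block(2)[OF part B(1)] by (auto simp: fibre_def)
qed

section \<open>The two constructions are mutually inverse\<close>

lemma code_partition_code:
  assumes "(\<sigma>, X) \<in> NC_NN n"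
  shows "code_partition n (partition_code n (\<sigma>, X)) = (\<sigma>, X)"
proof -
  have part: "partition_on {1..n} \<sigma>" and X: "X \<subseteq> \<sigma>" using assms by (auto simp: NC_NN_def NC_def)
  let ?G = "partition_code n (\<sigma>, X)"
  note G = partition_code_apply[OF part, of _ _ X]
  note fib = fibre_partition_code[OF part, of _ _ X]
  have neg: "?G i < 0 \<longleftrightarrow> B \<in> X" if "B \<in> \<sigma>" "i \<in> B" for i B
    using G[OF that] partition_on_block(4)[OF part that(1)] by auto
  have "fibre n ?G ` {1..n} = \<sigma>"
  proof (intro equalityI subsetI)
    fix B assume "B \<in> fibre n ?G ` {1..n}"
    then obtain i where i: "i \<in> {1..n}" "B = fibre n ?G i" by auto
    obtain C where "C \<in> \<sigma>" "i \<in> C" using partition_on_obtain[OF part i(1)] .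
    then show "B \<in> \<sigma>" using i fib by simp
  next
    fix B assume B: "B \<in> \<sigma>"
    then show "B \<in> fibre n ?G ` {1..n}"
      using fib[OF B partition_on_block(3)[OF part B]] partition_on_block(4)[OF part B] by blast
  qed
  moreover have "fibre n ?G ` {i \<in> {1..n}. ?G i < 0} = X"
  proof (intro equalityI subsetI)
    fix C assume "C \<in> fibre n ?G ` {i \<in> {1..n}. ?G i < 0}"
    then obtain i where i: "i \<in> {1..n}" "?G i < 0" "C = fibre n ?G i" by auto
    obtain B where B: "B \<in> \<sigma>" "i \<in> B" using partition_on_obtain[OF part i(1)] .
    then show "C \<in> X" using i fib[OF B] neg[OF B] by simp
  next
    fix B assume BX: "B \<in> X"
    then have B: "B \<in> \<sigma>" using X by blast
    note b = partition_on_block[OF part B]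
    show "B \<in> fibre n ?G ` {i \<in> {1..n}. ?G i < 0}"
      using fib[OF B b(3)] b(4) neg[OF B b(3)] BX by (intro image_eqI[of _ _ "Min B"]) auto
  qed
  ultimately show ?thesis by (simp add: code_partition_def)
qed

lemma partition_code_code_partition:
  assumes G: "G \<in> signed_codes n"
  shows "partition_code n (code_partition n G) = G"
proof (rule extensionalityI)
  show "partition_code n (code_partition n G) \<in> extensional {1..n}"
    by (simp add: partition_code_def code_partition_def)
  show "G \<in> extensional {1..n}" using G by (simp add: signed_codes_def)
  fix j assume j: "j \<in> {1..n}"
  let ?X = "fibre n G ` {i \<in> {1..n}. G i < 0}"
  have "fibre n G j \<in> ?X \<longleftrightarrow> (\<exists>i\<in>{1..n}. G i < 0 \<and> fibre n G j = fibre n G i)" by auto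
  also have "\<dots> \<longleftrightarrow> G j < 0" using fibre_eq_iff[OF j, of _ G] j by metis
  finally have "fibre n G j \<in> ?X \<longleftrightarrow> G j < 0" .
  then show "partition_code n (code_partition n G) j = G j"
    using partition_code_apply[OF partition_on_fibres imageI[OF j] fibre_self[OF j], of G ?X]
      Min_fibre[OF G j] by (auto simp: code_partition_def)
qed

lemma bij_betw_partition_code: "bij_betw (partition_code n) (NC_NN n) (signed_codes n)"
  by (rule bij_betw_byWitness[of _ "code_partition n"])
    (auto simp: code_partition_code partition_code_code_partition
      partition_code_signed_codes code_partition_NC_NN)

section \<open>Labels of rows and columns\<close>

text \<open>A zero-based counterpart of \<open>labels\<close> for arbitrary words, which allows
  induction on the word.\<close>

definition positions :: "'a \<Rightarrow> 'a list \<Rightarrow> nat list" where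
  "positions s p = filter (\<lambda>i. p ! i = s) [0..<length p]"

lemma positions_Nil [simp]: "positions s [] = []"
  by (simp add: positions_def)

lemma positions_Cons [simp]:
  "positions s (t # p) = (if t = s then [0] else []) @ map Suc (positions s p)"
proof -
  have "[0..<length (t # p)] = 0 # map Suc [0..<length p]"
    by (simp add: upt_conv_Cons map_Suc_upt del: upt_Suc)
  then show ?thesis by (simp add: positions_def filter_map o_def)
qed

text \<open>The word is built from its end. A west step in front adds an empty rightmost column, a
  south step in front adds a top row of full length; the new step gets position 0 and all others
  move up by one. The third claim is what lets cells be recognised by comparing labels.\<close>

lemma positions_boundary_from:
  assumes "sorted_wrt (\<ge>) ls" "\<forall>l\<in>set ls. l \<le> x"
  shows "length (positions South (boundary_from x ls)) = length ls"
    and "length (positions West (boundary_from x ls)) = x"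
    and "r < length ls \<Longrightarrow> c < x \<Longrightarrow>
      positions South (boundary_from x ls) ! r < rev (positions West (boundary_from x ls)) ! c \<longleftrightarrow>
        c < ls ! r"
proof -
  define Q where "Q x ls p \<longleftrightarrow> length (positions South p) = length ls \<and> length (positions West p) = x \<and>
    (\<forall>r<length ls. \<forall>c<x. positions South p ! r < rev (positions West p) ! c \<longleftrightarrow> c < ls ! r)"
    for x ls and p :: "step list"
  \<comment> \<open>The new column has index \<open>x\<close>, as \<open>rev\<close> sends position
    0 to the end; no row is long enough to meet it.\<close>
  have west: "Q (Suc x) ls (West # p)" if "Q x ls p" "\<forall>l\<in>set ls. l \<le> x" for x ls p
    using that by (fastforce simp: Q_def nth_append rev_map less_Suc_eq_le leD)
  have wests: "Q (d + x) ls (replicate d West @ p)" if "Q x ls p" "\<forall>l\<in>set ls. l \<le> x" for d x ls p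
    using that by (induction d) (auto intro!: west simp: trans_le_add2)
  have south: "Q x (x # ls) (South # p)" if "Q x ls p" for x ls p
    using that by (auto simp: Q_def nth_Cons' rev_map less_Suc_eq_0_disj)
  have "Q x ls (boundary_from x ls)"
    using assms
  proof (induction x ls rule: boundary_from.induct)
    case (1 x)
    have "Q 0 [] []" by (simp add: Q_def)
    then show ?case using wests[of 0 "[]" "[]" x] by simp
  next
    case (2 x l ls)
    then have "Q l (l # ls) (South # boundary_from l ls)" by (intro south) auto
    then show ?case using 2 wests[of l "l # ls" _ "x - l"] by auto
  qed
  then show "length (positions South (boundary_from x ls)) = length ls"
    and "length (positions West (boundary_from x ls)) = x"
    and "r < length ls \<Longrightarrow> c < x \<Longrightarrow>
      positions South (boundary_from x ls) ! r < rev (positions West (boundary_from x ls)) ! c \<longleftrightarrow>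
        c < ls ! r"
    by (auto simp: Q_def)
qed

section \<open>Labels of a fixed diagram and of its shifted diagram\<close>

locale ferrers_shape =
  fixes F :: ferrers
  assumes diagram: "ferrers_diagram F"
begin

lemma labels_positions: "labels s F = map Suc (positions s (boundary F))"
proof -
  have "[1..<Suc (ferrers_length F)] = map Suc [0..<length (boundary F)]"
    by (simp add: map_Suc_upt length_boundary[OF diagram] del: upt_Suc)
  then show ?thesis
    by (simp add: labels_def positions_def filter_map o_def boundary_step_def del: upt_Suc)
qed

lemma length_labels:
  "length (labels South F) = length (row_lens F)" "length (labels West F) = num_cols F"
  using positions_boundary_from(1,2)[of "row_lens F" "num_cols F"] diagram
  by (simp_all add: labels_positions ferrers_diagram_def boundary_def)

lemma row_label_less_col_label_iff:
  assumes "r < length (row_lens F)" "c < num_cols F"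
  shows "row_label F r < col_label F c \<longleftrightarrow> c < row_lens F ! r"
  using positions_boundary_from[of "row_lens F" "num_cols F"] diagram assms
  by (simp add: row_label_def col_label_def labels_positions ferrers_diagram_def boundary_def rev_map)

lemma sorted_labels: "sorted_wrt (<) (labels s F)"
  by (simp add: labels_def sorted_wrt_filter del: upt_Suc)

lemma row_label_strict_mono:
  assumes "r < r'" "r' < length (row_lens F)"
  shows "row_label F r < row_label F r'"
  using assms sorted_wrt_nth_less[OF sorted_labels, of r r'] by (simp add: row_label_def length_labels)

lemma col_label_strict_antimono:
  assumes "c < c'" "c' < num_cols F"
  shows "col_label F c' < col_label F c"
  using assms sorted_wrt_nth_less[of "(>)" "rev (labels West F)" c c'] sorted_labels
  by (simp add: col_label_def length_labels sorted_wrt_rev)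

lemma set_labels: "set (labels s F) = {i \<in> {1..ferrers_length F}. boundary_step F i = s}"
  by (auto simp: labels_def simp del: upt_Suc)

lemma row_label_image:
  "row_label F ` {..<length (row_lens F)} = {i \<in> {1..ferrers_length F}. boundary_step F i = South}"
proof -
  have "row_label F ` {..<length (row_lens F)} = set (labels South F)"
    by (auto simp: row_label_def[abs_def] length_labels[symmetric] in_set_conv_nth)
  then show ?thesis by (simp add: set_labels)
qed

lemma col_label_image:
  "col_label F ` {..<num_cols F} = {i \<in> {1..ferrers_length F}. boundary_step F i \<noteq> South}"
proof -
  have "col_label F ` {..<num_cols F} = set (rev (labels West F))"
    unfolding set_conv_nth by (auto simp: col_label_def length_labels)
  moreover have "s = West \<longleftrightarrow> s \<noteq> South" for s by (cases s) auto
  ultimately show ?thesis by (simp add: set_labels)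
qed

lemma row_labelD:
  assumes "r < length (row_lens F)"
  shows "row_label F r \<in> {1..ferrers_length F}" "boundary_step F (row_label F r) = South"
  using assms row_label_image by blast+

lemma col_labelD:
  assumes "c < num_cols F"
  shows "col_label F c \<in> {1..ferrers_length F}" "boundary_step F (col_label F c) \<noteq> South"
  using assms col_label_image by blast+

abbreviation "num_rows \<equiv> num_cols F + length (row_lens F)"

text \<open>Column labels decrease from left to right, so their negatives increase downwards along
  the new rows, and below these come the positive labels of the old rows.\<close>

lemma shifted_row_label_strict_mono:
  assumes "r < r'" "r' < num_rows"
  shows "shifted_row_label F r < shifted_row_label F r'"
proof -
  consider "r' < num_cols F" | "r < num_cols F" "num_cols F \<le> r'" | "num_cols F \<le> r"
    using assms by linarith
  then show ?thesis
  proof cases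
    case 1
    then show ?thesis using assms col_label_strict_antimono by (simp add: shifted_row_label_def)
  next
    case 2
    then show ?thesis
      using col_labelD(1)[of r] row_labelD(1)[of "r' - num_cols F"] assms
      by (simp add: shifted_row_label_def)
  next
    case 3
    then show ?thesis
      using assms row_label_strict_mono[of "r - num_cols F" "r' - num_cols F"]
      by (simp add: shifted_row_label_def)
  qed
qed

lemma shifted_row_label_less_iff:
  assumes "r < num_rows" "r' < num_rows"
  shows "shifted_row_label F r < shifted_row_label F r' \<longleftrightarrow> r < r'"
  using assms shifted_row_label_strict_mono
  by (metis less_asym less_irrefl linorder_neqE_nat)

lemma shifted_row_label_eq_iff:
  assumes "r < num_rows" "r' < num_rows"
  shows "shifted_row_label F r = shifted_row_label F r' \<longleftrightarrow> r = r'"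
  using assms shifted_row_label_strict_mono
  by (metis less_irrefl linorder_neqE_nat)

text \<open>One inequality between labels covers both kinds of rows. In a new row, equality is
  attained at the diagonal cell only. In an old row, \<open>\<le>\<close> amounts to
  \<open><\<close>, because a south label is never a west label.\<close>

lemma shifted_cells_iff:
  "(r, c) \<in> shifted_cells F \<longleftrightarrow>
     r < num_rows \<and> c < num_cols F \<and> nat \<bar>shifted_row_label F r\<bar> \<le> col_label F c"
proof (cases "r < num_cols F")
  case True
  have "(r, c) \<in> shifted_cells F \<longleftrightarrow> c < num_cols F \<and> c \<le> r"
    using True by (auto simp: shifted_cells_def shifted_row_lens_def nth_append simp del: upt_Suc)
  moreover have "c \<le> r \<longleftrightarrow> col_label F r \<le> col_label F c" if "c < num_cols F"
    using that True col_label_strict_antimono by (metis le_less_linear less_imp_le nless_le not_le)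
  ultimately show ?thesis using True by (auto simp: shifted_row_label_def)
next
  case False
  let ?r = "r - num_cols F"
  have "row_lens F ! ?r \<le> num_cols F" if "r < num_rows"
    using diagram that False by (simp add: ferrers_diagram_def)
  then have "(r, c) \<in> shifted_cells F \<longleftrightarrow> r < num_rows \<and> c < num_cols F \<and> c < row_lens F ! ?r"
    using False by (auto simp: shifted_cells_def shifted_row_lens_def nth_append simp del: upt_Suc)
  moreover have "c < row_lens F ! ?r \<longleftrightarrow> row_label F ?r \<le> col_label F c"
    if "r < num_rows" "c < num_cols F"
  proof -
    have r: "?r < length (row_lens F)" using that False by simp
    then have "row_label F ?r \<noteq> col_label F c"
      using row_labelD(2)[OF r] col_labelD(2)[OF that(2)] by auto
    then show ?thesis using row_label_less_col_label_iff[OF r that(2)] by auto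
  qed
  ultimately show ?thesis using False by (auto simp: shifted_row_label_def)
qed

lemma col_label_eq_iff:
  assumes "c < num_cols F" "c' < num_cols F"
  shows "col_label F c = col_label F c' \<longleftrightarrow> c = c'"
  using assms col_label_strict_antimono by (metis less_irrefl linorder_neqE_nat)

lemma obtain_column:
  assumes "j \<in> {1..ferrers_length F}" "boundary_step F j \<noteq> South"
  obtains c where "c < num_cols F" "col_label F c = j"
  using assms col_label_image by (metis (mono_tags, lifting) CollectI imageE lessThan_iff)

lemma obtain_row:
  assumes "i \<in> {1..ferrers_length F}" "boundary_step F i = South"
  obtains r where "r < num_rows" "shifted_row_label F r = int i"
proof -
  obtain r where "r < length (row_lens F)" "row_label F r = i"
    using assms row_label_image by (metis (mono_tags, lifting) CollectI imageE lessThan_iff)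
  then show ?thesis using that[of "num_cols F + r"] by (simp add: shifted_row_label_def)
qed

end

section \<open>From signed codes to tableaux\<close>

text \<open>For a signed code, \<open>G i = int i\<close> says that \<open>i\<close> is the minimum
  of a block with positive sign; this is thus \<open>shape_of\<close> in terms of codes.\<close>

definition code_shape :: "nat \<Rightarrow> (nat \<Rightarrow> int) \<Rightarrow> ferrers" where
  "code_shape n G = (THE F. ferrers_diagram F \<and> ferrers_length F = n \<and>
     (\<forall>i\<in>{1..n}. boundary_step F i = South \<longleftrightarrow> G i = int i))"

definition code_filling :: "ferrers \<Rightarrow> (nat \<Rightarrow> int) \<Rightarrow> nat \<times> nat \<Rightarrow> nat" where
  "code_filling F G = (\<lambda>(r, c)\<in>shifted_cells F.
     if shifted_row_label F r = G (col_label F c) then 1 else 0)"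

definition tableau :: "nat \<Rightarrow> (nat \<Rightarrow> int) \<Rightarrow> ferrers \<times> (nat \<times> nat \<Rightarrow> nat)" where
  "tableau n G = (code_shape n G, code_filling (code_shape n G) G)"

lemma code_shape:
  "ferrers_diagram (code_shape n G)" "ferrers_length (code_shape n G) = n"
  "i \<in> {1..n} \<Longrightarrow> boundary_step (code_shape n G) i = South \<longleftrightarrow> G i = int i"
  using theI'[OF shape_unique[of n "\<lambda>i. G i = int i"]] unfolding code_shape_def by blast+

lemma code_shape_eqI:
  assumes "ferrers_diagram F" "ferrers_length F = n"
    "\<And>i. i \<in> {1..n} \<Longrightarrow> boundary_step F i = South \<longleftrightarrow> G i = int i"
  shows "code_shape n G = F"
  unfolding code_shape_def
  by (rule the1_equality[OF shape_unique]) (use assms in auto)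

text \<open>Let \<open>j\<close> be the label of the column. At \<open>nat \<bar>G j\<bar>\<close>
  the code again takes the value \<open>G j\<close>. Hence this step is south if \<open>G j\<close>
  is positive, giving an old row, and west otherwise, giving the new row with the negated label. The
  cell exists since \<open>nat \<bar>G j\<bar> \<le> j\<close>.\<close>

lemma code_cell:
  assumes G: "G \<in> signed_codes n" and c: "c < num_cols (code_shape n G)"
  obtains r where "(r, c) \<in> shifted_cells (code_shape n G)"
    "shifted_row_label (code_shape n G) r = G (col_label (code_shape n G) c)"
proof -
  let ?F = "code_shape n G"
  interpret ferrers_shape ?F by standard (rule code_shape)
  let ?j = "col_label ?F c"
  have j: "?j \<in> {1..n}" using col_labelD(1)[OF c] by (simp add: code_shape)
  note Gj = signed_codesD[OF G j]
  obtain r where "r < num_rows" "shifted_row_label ?F r = G ?j"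
  proof (cases "G ?j > 0")
    case True
    then have "boundary_step ?F (nat \<bar>G ?j\<bar>) = South" using Gj by (simp add: code_shape)
    then show thesis using obtain_row[of "nat \<bar>G ?j\<bar>"] Gj True that by (auto simp: code_shape)
  next
    case False
    then have "boundary_step ?F (nat \<bar>G ?j\<bar>) \<noteq> South" using Gj by (simp add: code_shape)
    then obtain c' where "c' < num_cols ?F" "col_label ?F c' = nat \<bar>G ?j\<bar>"
      using obtain_column[of "nat \<bar>G ?j\<bar>"] Gj by (auto simp: code_shape)
    then show thesis using that[of c'] False by (simp add: shifted_row_label_def)
  qed
  then show thesis using that c Gj(2) by (simp add: shifted_cells_iff)
qed

text \<open>A 1 above and a 1 to the left of a cell are two columns violating the order condition,
  the existence of the cell supplying the bound on the absolute value. A 1 in a new row fixes the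
  value of \<open>G\<close> at the label of its diagonal column, which forces a 1 on the
  diagonal.\<close>

lemma tableau_CT_B:
  assumes G: "G \<in> signed_codes n"
  shows "tableau n G \<in> CT_B n"
proof -
  define F where "F = code_shape n G"
  define T where "T = code_filling F G"
  interpret ferrers_shape F by standard (simp add: F_def code_shape)
  have j: "col_label F c \<in> {1..n}" if "c < num_cols F" for c
    using col_labelD(1)[OF that] by (simp add: F_def code_shape)
  have T: "T (r, c) = (if shifted_row_label F r = G (col_label F c) then 1 else 0)"
    if "(r, c) \<in> shifted_cells F" for r c
    using that by (simp add: T_def code_filling_def)
  have one: "T (r, c) = 1 \<longleftrightarrow> shifted_row_label F r = G (col_label F c)"
    if "(r, c) \<in> shifted_cells F" for r c
    using T[OF that] by simp
  have ex1: "\<exists>!r. (r, c) \<in> shifted_cells F \<and> T (r, c) = 1" if c: "c < num_cols F" for c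
  proof -
    obtain r where "(r, c) \<in> shifted_cells F" "shifted_row_label F r = G (col_label F c)"
      using code_cell[OF G] c unfolding F_def by blast
    moreover have "r' = r''" if "(r', c) \<in> shifted_cells F" "T (r', c) = 1"
      "(r'', c) \<in> shifted_cells F" "T (r'', c) = 1" for r' r''
      using that one shifted_row_label_eq_iff[of r' r''] by (simp add: shifted_cells_iff)
    ultimately show ?thesis using one by blast
  qed
  have two: False if "(r, c) \<in> shifted_cells F"
    and r': "r' < r" "(r', c) \<in> shifted_cells F" "T (r', c) = 1"
    and c': "c' < c" "(r, c') \<in> shifted_cells F" "T (r, c') = 1" for r c r' c'
  proof -
    have c: "c < num_cols F" and r: "r < num_rows"
      and le: "nat \<bar>shifted_row_label F r\<bar> \<le> col_label F c"
      using that(1) by (auto simp: shifted_cells_iff)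
    have "G (col_label F c) < G (col_label F c')"
      using one[OF r'(2)] one[OF c'(2)] r' c' shifted_row_label_strict_mono[OF r'(1) r] by simp
    moreover have "col_label F c < col_label F c'" using col_label_strict_antimono[OF c'(1) c] .
    ultimately have "col_label F c < nat \<bar>G (col_label F c')\<bar>"
      using signed_codes_less[OF G j[OF c] j] c' c by simp
    then show False using le one[OF c'(2)] c' by simp
  qed
  have three: False if r: "r < num_cols F" "T (r, r) = 0"
    and c': "c' < r" "(r, c') \<in> shifted_cells F" "T (r, c') = 1"
    for r c'
  proof -
    have lab: "shifted_row_label F r = - int (col_label F r)"
      using r by (simp add: shifted_row_label_def)
    have "G (col_label F c') = - int (col_label F r)" using one[OF c'(2)] c' lab by simp
    moreover from this have "G (col_label F r) = G (col_label F c')"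
      using signed_codesD(4)[OF G j[of c']] c' r by simp
    ultimately have "T (r, r) = 1" using one[of r r] lab r by (simp add: shifted_cells_iff)
    then show False using r by simp
  qed
  have "T \<in> shifted_cells F \<rightarrow>\<^sub>E {0, 1}"
    by (auto simp: T_def code_filling_def split: if_splits)
  moreover have "\<exists>r. (r, c) \<in> shifted_cells F \<and> T (r, c) = 1" if "c < num_cols F" for c
    using ex1[OF that] by blast
  moreover have "ferrers_length F = n" by (simp add: F_def code_shape)
  ultimately have "(F, T) \<in> PT_B n"
    using two three diagram unfolding PT_B_def mem_Collect_eq prod.case by blast
  then show ?thesis using ex1 by (simp add: CT_B_def tableau_def F_def T_def)
qed

text \<open>The code can be read off: south labels are fixed points, and at a west label the value
  is the label of the row with the 1 of that column.\<close>

lemma inj_on_tableau: "inj_on (tableau n) (signed_codes n)"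
proof (rule inj_onI)
  fix G H assume G: "G \<in> signed_codes n" and H: "H \<in> signed_codes n"
    and eq: "tableau n G = tableau n H"
  define F where "F = code_shape n G"
  have F': "F = code_shape n H" and T: "code_filling F G = code_filling F H"
    using eq by (auto simp: tableau_def F_def)
  interpret ferrers_shape F by standard (simp add: F_def code_shape)
  show "G = H"
  proof (rule extensionalityI)
    show "G \<in> extensional {1..n}" "H \<in> extensional {1..n}"
      using G H by (simp_all add: signed_codes_def)
    fix j assume j: "j \<in> {1..n}"
    show "G j = H j"
    proof (cases "boundary_step F j = South")
      case True
      then show ?thesis using code_shape(3)[OF j, of G] code_shape(3)[OF j, of H] F' F_def by simp
    next
      case False
      then obtain c where c: "c < num_cols F" "col_label F c = j"
        using obtain_column[of j] j by (auto simp: F_def code_shape)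
      then obtain r where r: "(r, c) \<in> shifted_cells F" "shifted_row_label F r = G j"
        using code_cell[OF G] unfolding F_def by blast
      have "code_filling F G (r, c) = 1" using r c by (simp add: code_filling_def)
      then have "code_filling F H (r, c) = 1" using T by simp
      then show ?thesis using r c by (simp add: code_filling_def split: if_splits)
    qed
  qed
qed

text \<open>The code is read off as in the injectivity proof. The diagonal condition gives
  \<open>G (nat \<bar>G j\<bar>) = G j\<close> when the 1 lies in a new row, and the condition on
  zeros gives the order condition.\<close>

lemma CT_B_imp_tableau:
  assumes FT: "(F, T) \<in> CT_B n"
  obtains G where "G \<in> signed_codes n" "tableau n G = (F, T)"
proof -
  have PT: "(F, T) \<in> PT_B n"
    and ex1: "\<And>c. c < num_cols F \<Longrightarrow> \<exists>!r. (r, c) \<in> shifted_cells F \<and> T (r, c) = 1"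
    using FT by (auto simp: CT_B_def)
  have diag: "ferrers_diagram F" and len: "ferrers_length F = n"
    and T: "T \<in> shifted_cells F \<rightarrow>\<^sub>E {0, 1}"
    and zero: "\<forall>(r, c)\<in>shifted_cells F. T (r, c) = 0 \<longrightarrow>
        \<not> ((\<exists>r'<r. (r', c) \<in> shifted_cells F \<and> T (r', c) = 1) \<and>
           (\<exists>c'<c. (r, c') \<in> shifted_cells F \<and> T (r, c') = 1))"
    and zero_diag: "\<forall>r<num_cols F. T (r, r) = 0 \<longrightarrow>
        \<not> (\<exists>c'<r. (r, c') \<in> shifted_cells F \<and> T (r, c') = 1)"
    using PT unfolding PT_B_def mem_Collect_eq prod.case by - ((elim conjE, assumption)+)
  have two: False if "(r, c) \<in> shifted_cells F" "T (r, c) = 0" "r' < r" "(r', c) \<in> shifted_cells F"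
    "T (r', c) = 1" "c' < c" "(r, c') \<in> shifted_cells F" "T (r, c') = 1" for r c r' c'
    using that bspec[OF zero that(1)] by auto
  have three: False if "r < num_cols F" "T (r, r) = 0" "c' < r" "(r, c') \<in> shifted_cells F"
    "T (r, c') = 1" for r c'
    using that zero_diag by blast
  interpret ferrers_shape F by standard (rule diag)
  obtain \<rho> where \<rho>: "\<And>c. c < num_cols F \<Longrightarrow> (\<rho> c, c) \<in> shifted_cells F"
      "\<And>c. c < num_cols F \<Longrightarrow> T (\<rho> c, c) = 1"
    using ex1 by metis
  have \<rho>_eq: "\<rho> c = r" if "(r, c) \<in> shifted_cells F" "T (r, c) \<noteq> 0" for r c
  proof -
    have "T (r, c) = 1" using that T by (auto simp: PiE_iff)
    then show ?thesis using that ex1[of c] \<rho>[of c] by (auto simp: shifted_cells_iff)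
  qed
  let ?lab = "shifted_row_label F"
  \<comment> \<open>The definite description inverts \<open>col_label F\<close>, which is injective
    on the columns.\<close>
  define G where "G = (\<lambda>j\<in>{1..n}. if boundary_step F j = South then int j
    else ?lab (\<rho> (THE c. c < num_cols F \<and> col_label F c = j)))"
  have G_row: "G i = int i" if "i \<in> {1..n}" "boundary_step F i = South" for i
    using that by (simp add: G_def)
  have G_col: "G (col_label F c) = ?lab (\<rho> c)" if c: "c < num_cols F" for c
  proof -
    have "(THE c'. c' < num_cols F \<and> col_label F c' = col_label F c) = c"
      using c col_label_eq_iff by (intro the_equality) auto
    then show ?thesis using col_labelD[OF c] len by (simp add: G_def)
  qed
  have G_pos: "G (nat \<bar>?lab r\<bar>) = ?lab r" "?lab r \<noteq> 0"
    if "num_cols F \<le> r" "r < num_rows" for r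
  proof -
    have "r - num_cols F < length (row_lens F)" using that by simp
    note row_labelD[OF this]
    then show "G (nat \<bar>?lab r\<bar>) = ?lab r" "?lab r \<noteq> 0"
      using that G_row len by (auto simp: shifted_row_label_def)
  qed
  have G_neg: "?lab r = - int (col_label F r)" if "r < num_cols F" for r
    using that by (simp add: shifted_row_label_def)
  \<comment> \<open>The last conjunct keeps west labels from being fixed points, so that
    \<open>G\<close> gives back the shape \<open>F\<close>.\<close>
  have col: "G (col_label F c) \<noteq> 0 \<and> nat \<bar>G (col_label F c)\<bar> \<le> col_label F c \<and>
      G (nat \<bar>G (col_label F c)\<bar>) = G (col_label F c) \<and> G (col_label F c) \<noteq> int (col_label F c)"
    if c: "c < num_cols F" for c
  proof (cases "\<rho> c < num_cols F")
    case True
    note lab = G_neg[OF True]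
    have "col_label F (\<rho> c) > 0" using col_labelD(1)[OF True] by simp
    have le: "col_label F (\<rho> c) \<le> col_label F c"
      using \<rho>(1)[OF c] lab by (simp add: shifted_cells_iff)
    then have "c \<le> \<rho> c" using col_label_strict_antimono[of "\<rho> c" c] c by (meson not_le)
    have "T (\<rho> c, \<rho> c) \<noteq> 0"
    proof (cases "c = \<rho> c")
      case True then show ?thesis using \<rho>(2)[OF c] by simp
    next
      case False
      then show ?thesis using three[OF True _ _ \<rho>(1,2)[OF c]] \<open>c \<le> \<rho> c\<close> by auto
    qed
    \<comment> \<open>The new row \<open>\<rho> c\<close> has its diagonal cell in the column of the
      same index, and that cell holds the only 1 of this column.\<close>
    then have "\<rho> (\<rho> c) = \<rho> c" using True lab by (intro \<rho>_eq) (simp_all add: shifted_cells_iff)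
    then show ?thesis using G_col[OF c] G_col[OF True] lab le \<open>col_label F (\<rho> c) > 0\<close> by simp
  next
    case False
    have cell: "\<rho> c < num_rows" "nat \<bar>?lab (\<rho> c)\<bar> \<le> col_label F c"
      using \<rho>(1)[OF c] by (auto simp: shifted_cells_iff)
    have "G (nat \<bar>?lab (\<rho> c)\<bar>) = ?lab (\<rho> c)" "?lab (\<rho> c) \<noteq> 0"
      using G_pos[of "\<rho> c"] cell False by auto
    moreover have "?lab (\<rho> c) \<noteq> int (col_label F c)"
    proof -
      have "\<rho> c - num_cols F < length (row_lens F)" using False cell by simp
      from row_labelD(2)[OF this] show ?thesis
        using False col_labelD(2)[OF c] by (auto simp: shifted_row_label_def)
    qed
    ultimately show ?thesis using G_col[OF c] cell by simp
  qed
  have A: "G i \<noteq> 0 \<and> nat \<bar>G i\<bar> \<le> i \<and> G (nat \<bar>G i\<bar>) = G i \<and>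
      (boundary_step F i = South \<longleftrightarrow> G i = int i)"
    if i: "i \<in> {1..n}" for i
  proof (cases "boundary_step F i = South")
    case True
    then show ?thesis using G_row[OF i] i by simp
  next
    case False
    then obtain c where "c < num_cols F" "col_label F c = i" using obtain_column[of i] i len by auto
    then show ?thesis using col False by blast
  qed
  have B: False if i: "i \<in> {1..n}" and j: "j \<in> {1..n}" and ij: "i < j" "G i < G j" "nat \<bar>G j\<bar> \<le> i"
    for i j
  proof -
    \<comment> \<open>A south step \<open>i\<close> would have \<open>G i = int i\<close>, so
      \<open>G j\<close> would exceed \<open>i\<close>; a south step \<open>j\<close> would have
      \<open>\<bar>G j\<bar>\<close> equal to \<open>j\<close>. Both contradict the bound by
      \<open>i\<close>.\<close>
    have "boundary_step F i \<noteq> South" "boundary_step F j \<noteq> South" using G_row i j ij by fastforce+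
    then obtain c d where c: "c < num_cols F" "col_label F c = i"
      and d: "d < num_cols F" "col_label F d = j"
      using obtain_column i j len by metis
    have "d < c"
      using col_label_strict_antimono[of c d] c d ij by (metis linorder_neqE_nat not_less_iff_gr_or_eq)
    have Gi: "G i = ?lab (\<rho> c)" and Gj: "G j = ?lab (\<rho> d)" using G_col c d by auto
    have rows: "\<rho> c < num_rows" "\<rho> d < num_rows" using \<rho>(1) c d by (auto simp: shifted_cells_iff)
    then have lt: "\<rho> c < \<rho> d" using Gi Gj ij shifted_row_label_less_iff by simp
    \<comment> \<open>This is the corner below the 1 of column \<open>c\<close> and to the right of
      the 1 of column \<open>d\<close>; the bound on \<open>G j\<close> says that it lies in the
      diagram.\<close>
    have cell: "(\<rho> d, c) \<in> shifted_cells F" using rows c ij Gj by (simp add: shifted_cells_iff)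
    have "T (\<rho> d, c) = 0" using \<rho>_eq[OF cell] lt by auto
    then show False
      using two[OF cell _ lt \<rho>(1,2)[OF c(1)] \<open>d < c\<close> \<rho>(1,2)[OF d(1)]] by simp
  qed
  have ext: "G \<in> extensional {1..n}" by (simp add: G_def)
  have "G \<in> signed_codes n" unfolding signed_codes_def using A B ext not_le_imp_less by blast
  moreover have shape: "code_shape n G = F" using A by (intro code_shape_eqI diag len) auto
  moreover have "code_filling F G = T"
  proof (rule extensionalityI[of _ "shifted_cells F"])
    show "code_filling F G \<in> extensional (shifted_cells F)" "T \<in> extensional (shifted_cells F)"
      using T by (auto simp: code_filling_def PiE_def)
    fix x assume x: "x \<in> shifted_cells F"
    obtain r c where rc: "x = (r, c)" by (cases x)
    have c: "c < num_cols F" "r < num_rows" using x rc by (auto simp: shifted_cells_iff)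
    have "\<rho> c < num_rows" using \<rho>(1)[OF c(1)] by (auto simp: shifted_cells_iff)
    then have "code_filling F G x = (if r = \<rho> c then 1 else 0)"
      using x rc c G_col[OF c(1)] shifted_row_label_eq_iff[of r "\<rho> c"] by (simp add: code_filling_def)
    also have "\<dots> = T x"
    proof (cases "r = \<rho> c")
      case True
      then show ?thesis using \<rho>(2)[OF c(1)] rc by simp
    next
      case False
      then have "T (r, c) = 0" using \<rho>_eq x rc by metis
      then show ?thesis using False rc by simp
    qed
    finally show "code_filling F G x = T x" .
  qed
  ultimately show thesis using that by (simp add: tableau_def)
qed

lemma bij_betw_tableau: "bij_betw (tableau n) (signed_codes n) (CT_B n)"
proof (rule bij_betw_imageI[OF inj_on_tableau])
  show "tableau n ` signed_codes n = CT_B n"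
  proof (intro equalityI subsetI)
    fix p assume "p \<in> CT_B n"
    then show "p \<in> tableau n ` signed_codes n" using CT_B_imp_tableau by (cases p) (metis imageI)
  qed (use tableau_CT_B in auto)
qed

text \<open>Both sides have the same shape, since the fixed points of the code are the minima of the
  blocks outside \<open>X\<close>. In the column labelled \<open>j\<close>, the entry prescribed by
  \<open>one_entries\<close> is the one in the row labelled by the signed minimum of the block of
  \<open>j\<close>.\<close>

lemma f_map_eq:
  assumes "(\<sigma>, X) \<in> NC_NN n"
  shows "f_map n (\<sigma>, X) = tableau n (partition_code n (\<sigma>, X))"
proof -
  have part: "partition_on {1..n} \<sigma>" and X: "X \<subseteq> \<sigma>" using assms by (auto simp: NC_NN_def NC_def)
  let ?G = "partition_code n (\<sigma>, X)"
  note G = partition_code_apply[OF part, of _ _ X]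
  have South: "?G i = int i \<longleftrightarrow> (\<exists>B\<in>\<sigma> - X. i = Min B)" if i: "i \<in> {1..n}" for i
  proof -
    obtain B where B: "B \<in> \<sigma>" "i \<in> B" using partition_on_obtain[OF part i] .
    have "C = B" if "C \<in> \<sigma>" "i = Min C" for C
      using that B partition_on_block(3)[OF part that(1)]
        partition_on_block_unique[OF part that(1) B(1)] by blast
    then show ?thesis using G[OF B] B i by auto
  qed
  have shape: "shape_of n \<sigma> X = code_shape n ?G"
  proof -
    have "code_shape n ?G = shape_of n \<sigma> X"
      using theI'[OF shape_unique[of n "\<lambda>i. \<exists>B\<in>\<sigma> - X. i = Min B"]] South
      by (intro code_shape_eqI) (auto simp: shape_of_def)
    then show ?thesis by simp
  qed
  define F where "F = code_shape n ?G"
  interpret ferrers_shape F by standard (simp add: F_def code_shape)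
  have "(shifted_row_label F r, col_label F c) \<in> one_entries \<sigma> X \<longleftrightarrow>
      shifted_row_label F r = ?G (col_label F c)"
    if "(r, c) \<in> shifted_cells F" for r c
  proof -
    let ?j = "col_label F c"
    have c: "c < num_cols F" using that by (simp add: shifted_cells_iff)
    have j: "?j \<in> {1..n}" using col_labelD(1)[OF c] by (simp add: F_def code_shape)
    \<comment> \<open>A column label is never the minimum of a block outside \<open>X\<close>, so
      the side condition \<open>j \<noteq> Min B\<close> for such blocks holds automatically
      here.\<close>
    have west: "?G ?j \<noteq> int ?j"
      using col_labelD(2)[OF c] code_shape(3)[OF j, of ?G] by (simp add: F_def)
    obtain B where B: "B \<in> \<sigma>" "?j \<in> B" using partition_on_obtain[OF part j] .
    have uniq: "C \<in> \<sigma> \<and> ?j \<in> C \<longleftrightarrow> C = B" for C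
      using partition_on_block_unique[OF part _ B(1) _ B(2)] B by blast
    have Min_in: "Min C \<in> C" if "C \<in> \<sigma>" for C using partition_on_block(3)[OF part that] .
    \<comment> \<open>The two sets for blocks in \<open>X\<close> merge into one case, and every
      case now speaks of a block containing \<open>?j\<close>, so that \<open>uniq\<close> can
      replace it by \<open>B\<close>.\<close>
    have "(x, ?j) \<in> one_entries \<sigma> X \<longleftrightarrow> (\<exists>C. (C \<in> \<sigma> \<and> ?j \<in> C) \<and>
        (if C \<in> X then x = - int (Min C) else ?j \<noteq> Min C \<and> x = int (Min C)))" for x
    proof
      assume "(x, ?j) \<in> one_entries \<sigma> X"
      then consider C where "C \<in> X" "x = - int (Min C)" "?j = Min C \<or> ?j \<in> C"
        | C where "C \<in> \<sigma> - X" "x = int (Min C)" "?j \<in> C" "?j \<noteq> Min C"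
        unfolding one_entries_def by (elim UnE CollectE exE conjE) simp_all
      then show "\<exists>C. (C \<in> \<sigma> \<and> ?j \<in> C) \<and>
          (if C \<in> X then x = - int (Min C) else ?j \<noteq> Min C \<and> x = int (Min C))"
      proof cases
        case (1 C)
        then have "C \<in> \<sigma>" using X by blast
        then have "?j \<in> C" using 1 Min_in by metis
        then show ?thesis using 1 \<open>C \<in> \<sigma>\<close> by (intro exI[of _ C]) simp
      next
        case (2 C)
        then show ?thesis by (intro exI[of _ C]) simp
      qed
    next
      assume "\<exists>C. (C \<in> \<sigma> \<and> ?j \<in> C) \<and>
          (if C \<in> X then x = - int (Min C) else ?j \<noteq> Min C \<and> x = int (Min C))"
      then obtain C where C: "C \<in> \<sigma>" "?j \<in> C"
        "if C \<in> X then x = - int (Min C) else ?j \<noteq> Min C \<and> x = int (Min C)" by blast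
      then show "(x, ?j) \<in> one_entries \<sigma> X"
      proof (cases "C \<in> X")
        case True
        then have "(x, ?j) \<in> {(- int (Min B), Min B) |B. B \<in> X} \<or>
            (x, ?j) \<in> {(- int (Min B), j) |B j. B \<in> X \<and> j \<in> B \<and> j \<noteq> Min B}"
          using C by (cases "?j = Min C") (simp, blast)+
        then show ?thesis unfolding one_entries_def by simp
      next
        case False
        then have "(x, ?j) \<in> {(int (Min B), j) |B j. B \<in> \<sigma> - X \<and> j \<in> B \<and> j \<noteq> Min B}"
          using C by (simp, blast)
        then show ?thesis unfolding one_entries_def by simp
      qed
    qed
    then have "(x, ?j) \<in> one_entries \<sigma> X \<longleftrightarrow> x = ?G ?j" for x
      using west G[OF B] unfolding uniq by auto
    then show ?thesis .
  qed
  then have "(\<lambda>(r, c)\<in>shifted_cells F.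
      if (shifted_row_label F r, col_label F c) \<in> one_entries \<sigma> X then 1 else 0) = code_filling F ?G"
    unfolding code_filling_def by (intro restrict_ext) auto
  then show ?thesis by (simp add: f_map_def tableau_def shape F_def[symmetric] Let_def)
qed

theorem theorem8p1:
  fixes n :: nat
  assumes "n \<ge> 1"
  shows "bij_betw (f_map n) (NC_NN n) (CT_B n)"
proof -
  have "bij_betw (tableau n \<circ> partition_code n) (NC_NN n) (CT_B n)"
    by (rule bij_betw_trans[OF bij_betw_partition_code bij_betw_tableau])
  moreover have "f_map n p = (tableau n \<circ> partition_code n) p" if "p \<in> NC_NN n" for p
    using that f_map_eq by (cases p) auto
  ultimately show ?thesis using bij_betw_cong[of "NC_NN n" "f_map n"] by metis
qed

end
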